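(* The threshold choosing function AlphaTCF satisfies $1$-Goodness: for every positive integer $k$, every stream $A$ with at least $k$ distinct identifiers, every distinct identifier $\ell$ of $A$, and every fixed assignment $X^{n_A}_{-\ell}$ of hash values to the other distinct identifiers of $A$, the fix-all-but-one projection $x_\ell\mapsto T_\ell[X^{n_A}_{-\ell}](x_\ell)$ of AlphaTCF satisfies $1$-Goodness for univariate functions.
   Context: Identifiers come from $[n]$; a stream $A$ is a finite sequence of identifiers with $n_A$ distinct identifiers; a hash function $h:[n]\to(0,1)$; $h(A)$ is the sequence of hash values in stream order. AlphaTCF$(k,A,h)$: set $\alpha=k/(k+1)$; let the prefix be the shortest prefix of $h(A)$ containing exactly $k$ distinct hash values and the suffix the rest; $D$ := set of distinct hash values in the prefix; $i:=0$; for each $x$ in the suffix, in order: if $x<\alpha^i$ and $x\notin D$, then $i:=i+1$ and $D:=D\cup\{x\}$. Return $\theta=\alpha^i$. Its value depends on $h$ only through the hash values $X^{n_A}$ of the distinct identifiers of $A$; write $T(X^{n_A})$. Fix-all-but-one projection: $T_\ell[X^{n_A}_{-\ell}](x_\ell):=T(X^{n_A})$, with $X^{n_A}$ combining $X^{n_A}_{-\ell}$ and $x_\ell$. A function $f:(0,1)\to(0,1]$ satisfies $1$-Goodness if there is a threshold $F$ with $x<F\Rightarrow f(x)=F$ and $x\ge F\Rightarrow f(x)\le x$.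
   Formalization: The projection is shown 1-Good only for x_ℓ in (0,1) different from the hash values of the other distinct identifiers; at such a collision the claim can fail (k=1, A=(1,2), ℓ=2, X_1=c: value 1/2 except 1 at x_ℓ=c, and no threshold F fits). *)

theory Defs
  imports Complex_Main "HOL-Library.FuncSet"
begin

text \<open>
  A stream is a list of identifiers (natural numbers), and \<open>map h A\<close> is the sequence of its hash
  values. For a sequence with at least \<open>k\<close> distinct values, \<open>prefix_len k xs\<close> is the length of its
  shortest prefix with exactly \<open>k\<close> distinct values; if there is no such prefix (which, for a stream
  with at least \<open>k\<close> distinct identifiers, requires a hash collision), the prefix is the whole
  sequence.
\<close>

definition prefix_len :: "nat \<Rightarrow> real list \<Rightarrow> nat" where
  "prefix_len k xs = (LEAST m. card (set (take m xs)) = k \<or> m = length xs)"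

fun alpha_loop :: "real \<Rightarrow> nat \<Rightarrow> real set \<Rightarrow> real list \<Rightarrow> nat" where
  "alpha_loop \<alpha> i D [] = i"
| "alpha_loop \<alpha> i D (x # xs) =
     (if x < \<alpha> ^ i \<and> x \<notin> D then alpha_loop \<alpha> (Suc i) (insert x D) xs
      else alpha_loop \<alpha> i D xs)"

definition AlphaTCF :: "nat \<Rightarrow> nat list \<Rightarrow> (nat \<Rightarrow> real) \<Rightarrow> real" where
  "AlphaTCF k A h =
     (let \<alpha> = real k / (real k + 1);
          xs = map h A;
          m = prefix_len k xs
      in \<alpha> ^ alpha_loop \<alpha> 0 (set (take m xs)) (drop m xs))"

text \<open>
  Only the hash values of the identifiers occurring in the stream matter, so a total function
  \<open>X :: nat \<Rightarrow> real\<close> serves as the vector of hash values of the distinct identifiers.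
\<close>

lemma AlphaTCF_cong:
  assumes "\<And>j. j \<in> set A \<Longrightarrow> h j = h' j"
  shows "AlphaTCF k A h = AlphaTCF k A h'"
proof -
  have "map h A = map h' A" using assms by simp
  then show ?thesis by (simp only: AlphaTCF_def)
qed

text \<open>
  The value of \<open>X\<close> at \<open>l\<close> is overwritten, so \<open>X\<close> only plays the role of the values of the
  identifiers other than \<open>l\<close>.
\<close>

definition fix_all_but_one ::
    "((nat \<Rightarrow> real) \<Rightarrow> real) \<Rightarrow> nat \<Rightarrow> (nat \<Rightarrow> real) \<Rightarrow> real \<Rightarrow> real" where
  "fix_all_but_one T l X x = T (X(l := x))"

text \<open>
  1-Goodness of a univariate function with values in \<open>(0,1]\<close>, with the domain \<open>S \<subseteq> (0,1)\<close> as a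
  parameter.
\<close>

definition one_good_on :: "real set \<Rightarrow> (real \<Rightarrow> real) \<Rightarrow> bool" where
  "one_good_on S f \<longleftrightarrow>
     f \<in> S \<rightarrow> {0<..1} \<and>
     (\<exists>F. \<forall>x\<in>S. (x < F \<longrightarrow> f x = F) \<and> (x \<ge> F \<longrightarrow> f x \<le> x))"

text \<open>
  The values at which the hash value of \<open>l\<close> does not collide with that of another identifier of
  the stream. A projection of AlphaTCF need not be 1-Good on all of \<open>(0,1)\<close>, because the algorithm
  compares hash values rather than identifiers: for \<open>k = 1\<close>, the stream \<open>[1, 2]\<close>, \<open>l = 2\<close> and
  \<open>X 1 = c\<close>, the projection is \<open>1/2\<close> everywhere except that it is \<open>1\<close> at \<open>c\<close>, and no threshold
  fits.
\<close>

definition collision_free :: "nat list \<Rightarrow> nat \<Rightarrow> (nat \<Rightarrow> real) \<Rightarrow> real set" where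
  "collision_free A l X = {0<..<1} - X ` (set A - {l})"

end

(* The key point is that AlphaTCF never lets the value x of l influence the run except at the
   first occurrence of l in the suffix. If l already occurs in the prefix, then the projection is
   constant. Otherwise let alpha^i be the current threshold when l is first met in the suffix:
   neither i nor D depends on x up to there. If x < alpha^i, then x joins D and the rest of the
   run no longer depends on x, so the result is a constant F \<le> alpha^i. If x \<ge> alpha^i, then
   the result is at most alpha^i, hence at most x. *)

theory Submission
  imports Defs
begin

lemma alpha_loop_ge: "i \<le> alpha_loop \<alpha> i D xs"
proof (induction xs arbitrary: i D)
  case Nil
  then show ?case by simp
next
  case (Cons x xs)
  then show ?case by (auto intro: Suc_leD)
qed

lemma power_alpha_loop_le:
  fixes \<alpha> :: real
  assumes "0 \<le> \<alpha>" "\<alpha> \<le> 1"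
  shows "\<alpha> ^ alpha_loop \<alpha> i D xs \<le> \<alpha> ^ i"
  using assms by (intro power_decreasing alpha_loop_ge)

text \<open>With \<open>x\<close> already in \<open>D\<close>, every occurrence of \<open>l\<close>
  is skipped, and since no other identifier hashes to \<open>x\<close>, its presence alters no other
  membership test. The right-hand side is free of \<open>x\<close>, which is how results are shown
  to be constant.\<close>

lemma alpha_loop_fun_upd_insert:
  assumes "x \<notin> X ` (set B - {l})"
  shows "alpha_loop \<alpha> i (insert x D) (map (X(l := x)) B)
       = alpha_loop \<alpha> i D (map X (filter (\<lambda>a. a \<noteq> l) B))"
  using assms
proof (induction B arbitrary: i D)
  case Nil
  then show ?case by simp
next
  case (Cons a B)
  have IH: "alpha_loop \<alpha> i (insert x D) (map (X(l := x)) B)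
       = alpha_loop \<alpha> i D (map X (filter (\<lambda>a. a \<noteq> l) B))" for i D
    using Cons.prems by (intro Cons.IH) auto
  show ?case
  proof (cases "a = l")
    case True
    then show ?thesis using IH by (simp add: fun_upd_def)
  next
    case False
    with Cons.prems have "X a \<noteq> x" by auto
    then show ?thesis
      using False IH[of i D] IH[of "Suc i" "insert (X a) D"] by (simp add: insert_commute fun_upd_def)
  qed
qed

text \<open>The induction only has to reach the first \<open>l\<close>: before it, \<open>i\<close>
  and \<open>D\<close> evolve alike for all \<open>x\<close> in \<open>S\<close>. Keeping
  \<open>S\<close> disjoint from \<open>D\<close> reduces the test at \<open>l\<close> to
  \<open>x < \<alpha> ^ i\<close>.\<close>

lemma alpha_loop_threshold:
  fixes \<alpha> :: real
  assumes "0 \<le> \<alpha>" "\<alpha> \<le> 1" "S \<inter> D = {}" "S \<inter> X ` (set B - {l}) = {}"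
  shows "\<exists>F. \<forall>x\<in>S. (x < F \<longrightarrow> \<alpha> ^ alpha_loop \<alpha> i D (map (X(l := x)) B) = F)
                  \<and> (x \<ge> F \<longrightarrow> \<alpha> ^ alpha_loop \<alpha> i D (map (X(l := x)) B) \<le> x)"
  using assms(3,4)
proof (induction B arbitrary: i D)
  case Nil
  then show ?case by auto
next
  case (Cons a B)
  show ?case
  proof (cases "a = l")
    case False
    have B: "S \<inter> X ` (set B - {l}) = {}" using Cons.prems by auto
    have "S \<inter> insert (X a) D = {}" using Cons.prems False by auto
    from Cons.IH[OF this B, of "Suc i"] Cons.IH[OF Cons.prems(1) B, of i] False
    show ?thesis by (cases "X a < \<alpha> ^ i \<and> X a \<notin> D") auto
  next
    case True
    \<comment> \<open>The outcome once \<open>l\<close> is accepted, with its later occurrences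
      dropped.\<close>
    define F where "F = \<alpha> ^ alpha_loop \<alpha> (Suc i) D (map X (filter (\<lambda>a. a \<noteq> l) B))"
    have "F \<le> \<alpha> ^ Suc i"
      unfolding F_def using assms(1,2) by (rule power_alpha_loop_le)
    also have "\<dots> \<le> \<alpha> ^ i" using assms(1,2) by (intro power_decreasing) auto
    finally have F: "F \<le> \<alpha> ^ i" .
    have less: "\<alpha> ^ alpha_loop \<alpha> i D (map (X(l := x)) (a # B)) = F"
      if "x \<in> S" "x < \<alpha> ^ i" for x
    proof -
      have "x \<notin> D" "x \<notin> X ` (set B - {l})" using that Cons.prems by auto
      then show ?thesis
        using that True by (simp add: F_def alpha_loop_fun_upd_insert del: map_map)
    qed
    have ge: "\<alpha> ^ alpha_loop \<alpha> i D (map (X(l := x)) (a # B)) \<le> x" if "x \<ge> \<alpha> ^ i" for x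
      using power_alpha_loop_le[OF assms(1,2)] that by (rule order_trans)
    \<comment> \<open>Between \<open>F\<close> and \<open>\<alpha> ^ i\<close> the value is
      \<open>F\<close>, hence at most \<open>x\<close>; this is why \<open>F\<close> can be the
      threshold although acceptance is decided at \<open>\<alpha> ^ i\<close>.\<close>
    show ?thesis
      using less ge F by (intro exI[of _ F]) (metis linorder_not_le order_less_le_trans)
  qed
qed

lemma card_image_fun_upd:
  assumes "finite B" "x \<notin> X ` (B - {l})"
  shows "card (X(l := x) ` B) = card (X ` (B - {l})) + (if l \<in> B then 1 else 0)"
proof (cases "l \<in> B")
  case True
  then have "X(l := x) ` B = insert x (X ` (B - {l}))" by auto
  then show ?thesis using assms True by simp
next
  case False
  then have "X(l := x) ` B = X ` (B - {l})" by auto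
  then show ?thesis using False by simp
qed

text \<open>Each initial segment has the same number of distinct values for every collision-free
  value of \<open>l\<close>, so the cut does not move.\<close>

lemma prefix_len_fun_upd:
  assumes "x \<in> collision_free A l X" "y \<in> collision_free A l X"
  shows "prefix_len k (map (X(l := x)) A) = prefix_len k (map (X(l := y)) A)"
proof -
  have "card (X(l := z) ` set (take m A))
      = card (X ` (set (take m A) - {l})) + (if l \<in> set (take m A) then 1 else 0)"
    if "z \<in> collision_free A l X" for z m
    using that by (intro card_image_fun_upd) (auto simp: collision_free_def dest: in_set_takeD)
  then show ?thesis
    using assms by (simp add: prefix_len_def take_map del: fun_upd_apply)
qed

theorem theorem12:
  fixes n k l :: nat and A :: "nat list" and X :: "nat \<Rightarrow> real"
  assumes "k \<ge> 1"
    and "set A \<subseteq> {1..n}"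
    and "card (set A) \<ge> k"
    and "l \<in> set A"
    and "\<And>j. j \<in> set A - {l} \<Longrightarrow> X j \<in> {0<..<1}"
  shows "one_good_on (collision_free A l X) (fix_all_but_one (AlphaTCF k A) l X)"
proof -
  define \<alpha> where "\<alpha> = real k / (real k + 1)"
  define S where "S = collision_free A l X"
  define f where "f = fix_all_but_one (AlphaTCF k A) l X"
  have \<alpha>: "0 < \<alpha>" "\<alpha> \<le> 1" using assms(1) by (auto simp: \<alpha>_def)
  \<comment> \<open>An arbitrary point of \<open>S\<close> fixes the cut, making \<open>P\<close>
    and \<open>B\<close> independent of \<open>x\<close>.\<close>
  define m where "m = prefix_len k (map (X(l := (SOME x. x \<in> S))) A)"
  define P where "P = take m A"
  define B where "B = drop m A"
  have f_eq: "f x = \<alpha> ^ alpha_loop \<alpha> 0 (X(l := x) ` set P) (map (X(l := x)) B)"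
    if "x \<in> S" for x
  proof -
    have "prefix_len k (map (X(l := x)) A) = m"
      unfolding m_def using that someI[of "\<lambda>x. x \<in> S" x]
      by (intro prefix_len_fun_upd) (auto simp: S_def)
    then show ?thesis
      by (simp add: f_def fix_all_but_one_def AlphaTCF_def Let_def P_def B_def
          take_map drop_map flip: \<alpha>_def del: fun_upd_apply)
  qed
  have disjoint: "S \<inter> X ` (set P - {l}) = {}" "S \<inter> X ` (set B - {l}) = {}"
    by (auto simp: S_def P_def B_def collision_free_def dest: in_set_takeD in_set_dropD)
  have "\<exists>F. \<forall>x\<in>S. (x < F \<longrightarrow> f x = F) \<and> (x \<ge> F \<longrightarrow> f x \<le> x)"
  proof (cases "l \<in> set P")
    case True
    define F where
      "F = \<alpha> ^ alpha_loop \<alpha> 0 (X ` (set P - {l})) (map X (filter (\<lambda>a. a \<noteq> l) B))"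
    have "f x = F" if "x \<in> S" for x
    proof -
      have "X(l := x) ` set P = insert x (X ` (set P - {l}))" using True by auto
      moreover have "x \<notin> X ` (set B - {l})" using that disjoint by auto
      ultimately show ?thesis
        by (simp add: f_eq[OF that] F_def alpha_loop_fun_upd_insert del: fun_upd_apply)
    qed
    \<comment> \<open>A constant function has its own value as threshold.\<close>
    then show ?thesis by auto
  next
    case False
    \<comment> \<open>The initial \<open>D\<close> is now free of \<open>x\<close> and disjoint from
      \<open>S\<close>.\<close>
    then have "X(l := x) ` set P = X ` (set P - {l})" for x by auto
    then show ?thesis
      using alpha_loop_threshold[OF less_imp_le[OF \<alpha>(1)] \<alpha>(2) disjoint, of 0]
      by (simp add: f_eq del: fun_upd_apply cong: ball_cong)
  qed
  moreover have "f \<in> S \<rightarrow> {0<..1}"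
    using \<alpha> by (auto simp: f_eq power_le_one)
  ultimately show ?thesis unfolding one_good_on_def S_def f_def by blast
qed

end
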